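(* Let $n\ge1$ and let $$\rho=\sum_{x\in\{0,1\}^n}p_x|x\rangle\langle x|+c\bigl(|0^n\rangle\langle1^n|+|1^n\rangle\langle0^n|\bigr),\qquad c\in\mathbb R,$$ be a density operator (so $p_x\ge0$, $\sum_xp_x=1$, $c^2\le p_{0^n}p_{1^n}$). Write $p_{\mathbf0}=p_{0^n}$, $p_{\mathbf1}=p_{1^n}$. Then $\rho\in\mathcal S$ if and only if $|c|\le\min(p_{\mathbf0},p_{\mathbf1})$, and $$\mathcal R(\rho)=1+2\max\{0,\ |c|-p_{\mathbf0},\ |c|-p_{\mathbf1}\}.$$
   Context: $\mathcal S$ is the $n$-qubit stabilizer polytope: the convex hull of the density matrices of pure stabilizer states $C|0^n\rangle$, $C$ an $n$-qubit Clifford unitary. The robustness of magic is $\mathcal R(\rho)=\min\{\sum_j|q_j|:\rho=\sum_jq_j\sigma_j,\ q_j\in\mathbb R,\ \sigma_j\in\mathcal S\}$. *)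

theory Defs
  imports "Jordan_Normal_Form.Matrix"
begin

text \<open>n-qubit operators are complex matrices of dimension 2^n x 2^n; the computational
basis state |x> for a bit string x in {0,1}^n is identified with the basis index
x < 2^n (binary encoding, bit k of the index = k-th qubit). In particular
|0^n> has index 0 and |1^n> has index 2^n - 1.\<close>

definition adj :: "complex mat \<Rightarrow> complex mat" where
  "adj A = mat (dim_col A) (dim_row A) (\<lambda>(i,j). cnj (A $$ (j,i)))"

definition unitary_mat :: "nat \<Rightarrow> complex mat \<Rightarrow> bool" where
  "unitary_mat d U \<longleftrightarrow> U \<in> carrier_mat d d \<and> U * adj U = 1\<^sub>m d \<and> adj U * U = 1\<^sub>m d"

text \<open>Pauli string X^a Z^b on n qubits (a, b < 2^n encode bit strings):
  X^a Z^b |j> = (-1)^(b.j) |j xor a>.\<close>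
definition pauli :: "nat \<Rightarrow> nat \<Rightarrow> nat \<Rightarrow> complex mat" where
  "pauli n a b = mat (2^n) (2^n)
     (\<lambda>(i,j). if i = xor j a then (-1) ^ card {k. k < n \<and> bit b k \<and> bit j k} else 0)"

definition clifford :: "nat \<Rightarrow> complex mat \<Rightarrow> bool" where
  "clifford n U \<longleftrightarrow> unitary_mat (2^n) U \<and>
     (\<forall>a b. a < 2^n \<longrightarrow> b < 2^n \<longrightarrow>
        (\<exists>k::nat. \<exists>a' b'. a' < 2^n \<and> b' < 2^n \<and>
            U * pauli n a b * adj U = (\<i> ^ k) \<cdot>\<^sub>m pauli n a' b'))"

definition zero_proj :: "nat \<Rightarrow> complex mat" where
  "zero_proj n = mat (2^n) (2^n) (\<lambda>(i,j). if i = 0 \<and> j = 0 then 1 else 0)"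

definition stab_states :: "nat \<Rightarrow> complex mat set" where
  "stab_states n = {C * zero_proj n * adj C | C. clifford n C}"

definition lin_comb :: "nat \<Rightarrow> nat \<Rightarrow> (nat \<Rightarrow> real) \<Rightarrow> (nat \<Rightarrow> complex mat) \<Rightarrow> complex mat" where
  "lin_comb n m q \<sigma> = mat (2^n) (2^n) (\<lambda>(i,j). \<Sum>l<m. complex_of_real (q l) * (\<sigma> l $$ (i,j)))"

definition stab_polytope :: "nat \<Rightarrow> complex mat set" where
  "stab_polytope n = {lin_comb n m w \<sigma> | m w \<sigma>.
      (\<forall>l<m. w l \<ge> 0 \<and> \<sigma> l \<in> stab_states n) \<and> (\<Sum>l<m. w l) = 1}"

definition robustness :: "nat \<Rightarrow> complex mat \<Rightarrow> real" where
  "robustness n \<rho> = Inf {(\<Sum>l<m. \<bar>q l\<bar>) | m q \<sigma>.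
      (\<forall>l<m. \<sigma> l \<in> stab_polytope n) \<and> \<rho> = lin_comb n m q \<sigma>}"

definition x_state :: "nat \<Rightarrow> (nat \<Rightarrow> real) \<Rightarrow> real \<Rightarrow> complex mat" where
  "x_state n p c = mat (2^n) (2^n) (\<lambda>(i,j).
      (if i = j then complex_of_real (p i) else 0)
    + (if (i = 0 \<and> j = 2^n - 1) \<or> (i = 2^n - 1 \<and> j = 0) then complex_of_real c else 0))"

end

theory Submission
  imports Defs
begin

text \<open>Let N = 2^n - 1. Every pure stabilizer state satisfies
|\<sigma>(0,N)| \<le> min (\<sigma>(0,0)) (\<sigma>(N,N)): if \<sigma>(0,N) is nonzero, some conjugated
Z-string C Z^b C* has a nonzero (0,N) entry; it is a Pauli string up to a phase, it exchanges |0>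
and |N>, and it fixes \<sigma>, which forces the absolute values to agree. Hence, for s = 1 and s = -1 and for
x = 0 and x = N, the linear functional \<sigma>(x,x) - s Re \<sigma>(0,N) takes values in [0,1] on the polytope, and
an affine combination on which it equals -t has negative weights of total at least t.

Conversely, if |c| \<le> min (p 0) (p N), the state is a mixture of basis states and one GHZ state with
the sign of c. If p x < |c| for one of the two corners x, adding t = |c| - p x times |x><x|
produces (1 + t) times such a mixture.\<close>

section \<open>Pauli strings\<close>

text \<open>The character of {0,1}^n under bitwise xor with label b: the eigenvalue of the Pauli
  string Z^b at |j>.\<close>

definition zsign :: "nat \<Rightarrow> nat \<Rightarrow> nat \<Rightarrow> complex" where
  "zsign n b j = (-1) ^ card {k. k < n \<and> bit b k \<and> bit j k}"

text \<open>As a product over qubits the sign can be compared bit by bit, which is how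
  multiplicativity in xor is proved.\<close>

lemma zsign_eq_prod: "zsign n b j = (\<Prod>k<n. if bit b k \<and> bit j k then -1 else 1)"
proof -
  have "{..<n} \<inter> {k. bit b k \<and> bit j k} = {k. k < n \<and> bit b k \<and> bit j k}" by auto
  then show ?thesis by (simp add: zsign_def prod.If_cases)
qed

lemma zsign_commute: "zsign n b j = zsign n j b"
  by (simp add: zsign_def conj_commute)

lemma zsign_xor_right: "zsign n b (xor i j) = zsign n b i * zsign n b j"
  unfolding zsign_eq_prod prod.distrib[symmetric]
  by (rule prod.cong) (auto simp: bit_xor_iff)

lemma zsign_xor_left: "zsign n (xor a b) j = zsign n a j * zsign n b j"
  by (metis zsign_commute zsign_xor_right)

lemma zsign_square [simp]: "zsign n b j * zsign n b j = 1"
  by (simp add: zsign_def flip: power_mult_distrib)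

lemma zsign_cases: "zsign n b j = 1 \<or> zsign n b j = -1"
  by (simp add: zsign_def) (metis neg_one_even_power neg_one_odd_power)

lemma cnj_zsign [simp]: "cnj (zsign n b j) = zsign n b j"
  by (simp add: zsign_def)

lemma norm_zsign [simp]: "norm (zsign n b j) = 1"
  by (simp add: zsign_def norm_power)

lemma zsign_zero [simp]: "zsign n 0 j = 1" "zsign n b 0 = 1"
  by (simp_all add: zsign_def)

lemma xor_less_exp:
  fixes a b :: nat
  assumes "a < 2 ^ n" "b < 2 ^ n"
  shows "xor a b < 2 ^ n"
proof -
  have "take_bit n (xor a b) = xor a b"
    using assms by (simp add: take_bit_nat_eq_self)
  then show ?thesis by (metis take_bit_nat_less_exp)
qed

lemma xor_cancel_right [simp]: "xor (xor a b) b = (a :: nat)"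
  by (simp add: xor.assoc)

lemma eq_xor_iff: "i = xor j a \<longleftrightarrow> j = xor i (a :: nat)"
  by (metis xor_cancel_right)

text \<open>Orthogonality of characters: if bit k of j is set, xor with 2^k permutes the labels b
  and flips every sign, so the sum equals its own negative.\<close>

lemma sum_zsign:
  assumes "j < 2 ^ n"
  shows "(\<Sum>b<2^n. zsign n b j) = (if j = 0 then 2 ^ n else 0)"
proof (cases "j = 0")
  case False
  then obtain k where k: "bit j k" by (metis bit_eq_iff bit_0_eq bot_apply bot_bool_def)
  have kn: "k < n"
  proof (rule ccontr)
    assume "\<not> k < n"
    moreover have "take_bit n j = j" using assms by (simp add: take_bit_nat_eq_self)
    ultimately show False using k by (metis bit_take_bit_iff)
  qed
  define e :: nat where "e = 2 ^ k"
  have e: "e < 2 ^ n" using kn by (simp add: e_def)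
  have "{k'. k' < n \<and> bit e k' \<and> bit j k'} = {k}"
    using k kn by (auto simp: e_def bit_exp_iff)
  then have ej: "zsign n e j = -1" by (simp add: zsign_def)
  have "bij_betw (\<lambda>b. xor b e) {..<2^n} {..<2^n}"
    by (rule bij_betw_byWitness[where f' = "\<lambda>b. xor b e"]) (auto intro: xor_less_exp e)
  then have "(\<Sum>b<2^n. zsign n b j) = (\<Sum>b<2^n. zsign n (xor b e) j)"
    by (rule sum.reindex_bij_betw[symmetric])
  also have "\<dots> = - (\<Sum>b<2^n. zsign n b j)"
    by (simp add: zsign_xor_left ej sum_negf)
  finally show ?thesis using False by simp
qed simp

text \<open>Summing all Walsh coefficients leaves 2^n times \<open>f 0\<close>, by orthogonality.
  Used contrapositively: a nonzero \<open>f 0\<close> yields a label b with a nonzero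
  coefficient.\<close>

lemma walsh_transform_injective:
  fixes f :: "nat \<Rightarrow> complex"
  assumes "\<And>b. b < 2 ^ n \<Longrightarrow> (\<Sum>j<2^n. f j * zsign n b j) = 0"
  shows "f 0 = 0"
proof -
  have "0 = (\<Sum>b<2^n. \<Sum>j<2^n. f j * zsign n b j)" using assms by simp
  also have "\<dots> = (\<Sum>j<2^n. f j * (\<Sum>b<2^n. zsign n b j))"
    by (subst sum.swap) (simp add: sum_distrib_left)
  also have "\<dots> = (\<Sum>j<(2::nat)^n. if j = 0 then f 0 * 2 ^ n else 0)"
    by (rule sum.cong) (auto simp: sum_zsign)
  also have "\<dots> = f 0 * 2 ^ n" by simp
  finally show ?thesis by simp
qed

section \<open>Pauli strings as matrices and their products\<close>

lemma pauli_carrier [simp]: "pauli n a b \<in> carrier_mat (2^n) (2^n)"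
  by (simp add: pauli_def)

lemma pauli_dim [simp]: "dim_row (pauli n a b) = 2^n" "dim_col (pauli n a b) = 2^n"
  by (simp_all add: pauli_def)

lemma pauli_index:
  "i < 2^n \<Longrightarrow> j < 2^n \<Longrightarrow> pauli n a b $$ (i,j) = (if i = xor j a then zsign n b j else 0)"
  by (simp add: pauli_def zsign_def)

lemma pauli_zero_zero: "pauli n 0 0 = 1\<^sub>m (2^n)"
  by (rule eq_matI) (auto simp: pauli_index)

lemma mat_mult_index:
  assumes "A \<in> carrier_mat d d" "B \<in> carrier_mat d d" "i < d" "j < d"
  shows "(A * B) $$ (i,j) = (\<Sum>l<d. A $$ (i,l) * B $$ (l,j))"
  using assms by (auto simp: scalar_prod_def atLeast0LessThan)

lemma one_smult_mat [simp]: "(1 :: 'a :: monoid_mult) \<cdot>\<^sub>m A = A"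
  by (rule eq_matI) auto

lemma smult_smult_mat [simp]: "(k :: 'a :: semigroup_mult) \<cdot>\<^sub>m (l \<cdot>\<^sub>m A) = (k * l) \<cdot>\<^sub>m A"
  by (rule eq_matI) (auto simp: mult.assoc)

lemma square_mult_carrier [simp]:
  "A \<in> carrier_mat d d \<Longrightarrow> B \<in> carrier_mat d d \<Longrightarrow> A * B \<in> carrier_mat d d"
  by (rule mult_carrier_mat)

lemma square_mat_distribs:
  fixes A B M :: "'a :: comm_semiring_0 mat"
  assumes "A \<in> carrier_mat d d" "B \<in> carrier_mat d d" "M \<in> carrier_mat d d"
  shows "(A + B) * M = A * M + B * M" "M * (A + B) = M * A + M * B"
  using assms by (auto intro: add_mult_distrib_mat mult_add_distrib_mat)

lemma square_mat_smults:
  fixes A B :: "'a :: comm_semiring_0 mat"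
  assumes "A \<in> carrier_mat d d" "B \<in> carrier_mat d d"
  shows "(k \<cdot>\<^sub>m A) * B = k \<cdot>\<^sub>m (A * B)" "A * (k \<cdot>\<^sub>m B) = k \<cdot>\<^sub>m (A * B)"
  using assms by (auto intro: mult_smult_assoc_mat mult_smult_distrib)

text \<open>Moving Z^b to the right past X^a' costs the sign (-1)^(b.a').\<close>

lemma pauli_mult:
  assumes "a' < 2 ^ n"
  shows "pauli n a b * pauli n a' b' = zsign n b a' \<cdot>\<^sub>m pauli n (xor a a') (xor b b')"
proof (rule eq_matI)
  fix i j assume "i < dim_row (zsign n b a' \<cdot>\<^sub>m pauli n (xor a a') (xor b b'))"
    "j < dim_col (zsign n b a' \<cdot>\<^sub>m pauli n (xor a a') (xor b b'))"
  then have ij: "i < 2^n" "j < 2^n" by simp_all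
  have l: "xor j a' < 2^n" using ij assms by (simp add: xor_less_exp)
  have "(pauli n a b * pauli n a' b') $$ (i,j)
      = (\<Sum>l<2^n. pauli n a b $$ (i,l) * pauli n a' b' $$ (l,j))"
    using ij by (intro mat_mult_index) auto
  also have "\<dots> = (\<Sum>l<2^n. if l = xor j a' then pauli n a b $$ (i,l) * zsign n b' j else 0)"
    using ij by (intro sum.cong) (auto simp: pauli_index)
  also have "\<dots> = pauli n a b $$ (i, xor j a') * zsign n b' j"
    using l by simp
  also have "\<dots> = (zsign n b a' \<cdot>\<^sub>m pauli n (xor a a') (xor b b')) $$ (i,j)"
    using ij l by (simp add: pauli_index zsign_xor_left zsign_xor_right xor.assoc xor.commute[of a'])
  finally show "(pauli n a b * pauli n a' b') $$ (i,j)
      = (zsign n b a' \<cdot>\<^sub>m pauli n (xor a a') (xor b b')) $$ (i,j)" .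
qed simp_all

text \<open>Both orders give the same string up to a sign, so Pauli strings commute or anticommute;
  the product of the two signs is the symplectic pairing of the labels.\<close>

lemma pauli_commute:
  assumes "a < 2 ^ n" "a' < 2 ^ n"
  shows "pauli n a b * pauli n a' b'
    = (zsign n b a' * zsign n b' a) \<cdot>\<^sub>m (pauli n a' b' * pauli n a b)"
  using assms by (intro eq_matI) (auto simp: pauli_mult xor.commute[of a] xor.commute[of b])

section \<open>Adjoints\<close>

lemma adj_carrier [simp]: "A \<in> carrier_mat d d \<Longrightarrow> adj A \<in> carrier_mat d d"
  by (auto simp: adj_def)

lemma adj_index: "A \<in> carrier_mat d d \<Longrightarrow> i < d \<Longrightarrow> j < d \<Longrightarrow> adj A $$ (i,j) = cnj (A $$ (j,i))"
  by (auto simp: adj_def)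

lemma adj_dim [simp]: "dim_row (adj A) = dim_col A" "dim_col (adj A) = dim_row A"
  by (simp_all add: adj_def)

text \<open>The adjoint of X^a Z^b is Z^b X^a; restoring the order costs the sign.\<close>

lemma adj_pauli: "adj (pauli n a b) = zsign n b a \<cdot>\<^sub>m pauli n a b"
proof (rule eq_matI)
  fix i j assume "i < dim_row (zsign n b a \<cdot>\<^sub>m pauli n a b)" "j < dim_col (zsign n b a \<cdot>\<^sub>m pauli n a b)"
  then have ij: "i < 2^n" "j < 2^n" by simp_all
  then have "adj (pauli n a b) $$ (i,j) = (if j = xor i a then zsign n b i else 0)"
    by (simp add: adj_index[OF pauli_carrier] pauli_index)
  also have "\<dots> = (if i = xor j a then zsign n b (xor j a) else 0)"
    using eq_xor_iff[of i j a] by auto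
  finally show "adj (pauli n a b) $$ (i,j) = (zsign n b a \<cdot>\<^sub>m pauli n a b) $$ (i,j)"
    using ij by (simp add: pauli_index zsign_xor_right)
qed simp_all


lemma adj_smult: "adj (k \<cdot>\<^sub>m A) = cnj k \<cdot>\<^sub>m adj A"
  by (rule eq_matI) (auto simp: adj_def)

lemma adj_add:
  "A \<in> carrier_mat d d \<Longrightarrow> B \<in> carrier_mat d d \<Longrightarrow> adj (A + B) = adj A + adj B"
  by (rule eq_matI) (auto simp: adj_def)

lemma adj_one: "adj (1\<^sub>m d) = 1\<^sub>m d"
  by (rule eq_matI) (auto simp: adj_def)

section \<open>Basis states and GHZ states are stabilizer states\<close>

lemma sign_is_power_of_i: "z = 1 \<or> z = -1 \<Longrightarrow> \<exists>k::nat. z = \<i> ^ k"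
  by (metis power_0 i_squared power2_i)

text \<open>Conjugation by X^x only multiplies X^a Z^b by the sign (-1)^(b.x).\<close>

lemma clifford_pauli_X:
  assumes "x < 2 ^ n"
  shows "clifford n (pauli n x 0)"
proof -
  have "\<exists>k::nat. \<exists>a' b'. a' < 2^n \<and> b' < 2^n \<and>
      pauli n x 0 * pauli n a b * adj (pauli n x 0) = (\<i> ^ k) \<cdot>\<^sub>m pauli n a' b'"
    if "a < 2 ^ n" "b < 2 ^ n" for a b
  proof -
    obtain k :: nat where k: "zsign n b x = \<i> ^ k"
      using sign_is_power_of_i[OF zsign_cases] by blast
    have "pauli n x 0 * pauli n a b * adj (pauli n x 0) = (\<i> ^ k) \<cdot>\<^sub>m pauli n a b"
      using that assms k
      by (simp add: adj_pauli pauli_mult xor.commute[of x a])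
    with that show ?thesis by blast
  qed
  moreover have "pauli n x 0 * adj (pauli n x 0) = 1\<^sub>m (2^n)"
    "adj (pauli n x 0) * pauli n x 0 = 1\<^sub>m (2^n)"
    using assms by (simp_all add: adj_pauli pauli_mult pauli_zero_zero)
  ultimately show ?thesis by (simp add: clifford_def unitary_mat_def)
qed

text \<open>The state is the outer product of column 0 of C, the vector C|0>, with itself.\<close>

lemma stab_state_index:
  assumes "C \<in> carrier_mat (2^n) (2^n)" "i < 2^n" "j < 2^n"
  shows "(C * zero_proj n * adj C) $$ (i,j) = C $$ (i,0) * cnj (C $$ (j,0))"
proof -
  have zp: "zero_proj n \<in> carrier_mat (2^n) (2^n)" by (simp add: zero_proj_def)
  have Cz: "(C * zero_proj n) $$ (i,l) = (if l = 0 then C $$ (i,0) else 0)" if "l < 2^n" for l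
  proof -
    have "(C * zero_proj n) $$ (i,l) = (\<Sum>k<2^n. C $$ (i,k) * zero_proj n $$ (k,l))"
      using assms zp that by (intro mat_mult_index)
    also have "\<dots> = (\<Sum>k<(2::nat)^n. if k = 0 then (if l = 0 then C $$ (i,0) else 0) else 0)"
      using that by (intro sum.cong) (auto simp: zero_proj_def)
    finally show ?thesis by simp
  qed
  have "(C * zero_proj n * adj C) $$ (i,j) = (\<Sum>l<2^n. (C * zero_proj n) $$ (i,l) * adj C $$ (l,j))"
    using assms zp by (intro mat_mult_index) auto
  also have "\<dots> = (\<Sum>l<(2::nat)^n. if l = 0 then C $$ (i,0) * cnj (C $$ (j,0)) else 0)"
    using assms by (intro sum.cong) (auto simp: Cz adj_index)
  finally show ?thesis by simp
qed

lemma stab_state_carrier: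
  "C \<in> carrier_mat (2^n) (2^n) \<Longrightarrow> C * zero_proj n * adj C \<in> carrier_mat (2^n) (2^n)"
  by (intro mult_carrier_mat) (auto simp: zero_proj_def)

definition basis_proj :: "nat \<Rightarrow> nat \<Rightarrow> complex mat" where
  "basis_proj n x = mat (2^n) (2^n) (\<lambda>(i,j). if i = x \<and> j = x then 1 else 0)"

text \<open>X^x maps |0> to |x>.\<close>

lemma basis_proj_stab:
  assumes "x < 2 ^ n"
  shows "basis_proj n x \<in> stab_states n"
proof -
  have "basis_proj n x = pauli n x 0 * zero_proj n * adj (pauli n x 0)"
  proof (rule eq_matI)
    fix i j
    assume "i < dim_row (pauli n x 0 * zero_proj n * adj (pauli n x 0))"
      "j < dim_col (pauli n x 0 * zero_proj n * adj (pauli n x 0))"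
    then have ij: "i < 2^n" "j < 2^n" by auto
    then show "basis_proj n x $$ (i,j) = (pauli n x 0 * zero_proj n * adj (pauli n x 0)) $$ (i,j)"
      using assms by (subst stab_state_index) (auto simp: pauli_index basis_proj_def)
  qed (simp_all add: basis_proj_def)
  then show ?thesis
    using clifford_pauli_X[OF assms] by (auto simp: stab_states_def)
qed

text \<open>For real s, the string P = X^N Z^1 satisfies P* = -P and P P = -1, so (1 + s P)/sqrt 2 with
s = 1 or s = -1 is unitary; it maps |0> to (|0> + s |N>)/sqrt 2.\<close>
definition pauli_rot :: "nat \<Rightarrow> complex \<Rightarrow> complex mat" where
  "pauli_rot n s = complex_of_real (1 / sqrt 2) \<cdot>\<^sub>m (1\<^sub>m (2^n) + s \<cdot>\<^sub>m pauli n (2^n - 1) 1)"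

lemma pauli_rot_carrier [simp]: "pauli_rot n s \<in> carrier_mat (2^n) (2^n)"
  by (simp add: pauli_rot_def)

lemma inv_sqrt2_square: "complex_of_real (1 / sqrt 2) * complex_of_real (1 / sqrt 2) = 1/2"
  by (simp flip: of_real_mult)

text \<open>The strings 1 and 2^n - 1 share only bit 0. This sign is what makes P square to -1 and
  P* equal -P.\<close>

lemma zsign_one_full:
  assumes "n \<ge> 1"
  shows "zsign n 1 (2^n - 1) = -1"
proof -
  have "{k. k < n \<and> bit (1::nat) k \<and> bit (2^n - 1 :: nat) k} = {0}"
    using assms by (auto simp: bit_1_iff bit_mask_iff simp del: One_nat_def simp flip: mask_eq_exp_minus_1)
  then show ?thesis by (simp add: zsign_def)
qed

text \<open>Because P P = -1, expanding the product leaves only multiples of 1 and P. For t = -s the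
  P term cancels, which gives unitarity when s is 1 or -1.\<close>

lemma pauli_rot_mult:
  assumes "n \<ge> 1"
  shows "pauli_rot n s * pauli_rot n t
    = ((1 - s * t) / 2) \<cdot>\<^sub>m 1\<^sub>m (2^n) + ((s + t) / 2) \<cdot>\<^sub>m pauli n (2^n - 1) 1"
proof -
  let ?d = "2 ^ n" and ?P = "pauli n (2^n - 1) 1"
  let ?r = "complex_of_real (1 / sqrt 2)"
  have PP: "?P * ?P = (-1) \<cdot>\<^sub>m 1\<^sub>m ?d"
    using assms by (simp add: pauli_mult zsign_one_full[simplified] pauli_zero_zero)
  have "pauli_rot n s * pauli_rot n t
      = (?r * ?r) \<cdot>\<^sub>m ((1\<^sub>m ?d + s \<cdot>\<^sub>m ?P) * (1\<^sub>m ?d + t \<cdot>\<^sub>m ?P))"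
    unfolding pauli_rot_def by (simp add: square_mat_smults[of _ ?d])
  also have "(1\<^sub>m ?d + s \<cdot>\<^sub>m ?P) * (1\<^sub>m ?d + t \<cdot>\<^sub>m ?P)
      = 1\<^sub>m ?d + s \<cdot>\<^sub>m ?P + t \<cdot>\<^sub>m (?P + s \<cdot>\<^sub>m (?P * ?P))"
    by (simp add: square_mat_distribs[of _ ?d] square_mat_smults[of _ ?d])
  also have "(?r * ?r) \<cdot>\<^sub>m (1\<^sub>m ?d + s \<cdot>\<^sub>m ?P + t \<cdot>\<^sub>m (?P + s \<cdot>\<^sub>m (?P * ?P))) = ((1 - s * t) / 2) \<cdot>\<^sub>m 1\<^sub>m ?d + ((s + t) / 2) \<cdot>\<^sub>m ?P"
    unfolding PP inv_sqrt2_square by (rule eq_matI) (auto simp: field_simps)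
  finally show ?thesis .
qed

lemma pauli_rot_adj:
  assumes "n \<ge> 1" "cnj s = s"
  shows "adj (pauli_rot n s) = pauli_rot n (-s)"
  unfolding pauli_rot_def adj_smult
  by (subst adj_add[of _ "2^n"])
     (auto simp: adj_smult adj_one adj_pauli zsign_one_full[OF assms(1), simplified] assms(2))

text \<open>A Pauli string Q that commutes with P is left alone by the conjugation; one that
  anticommutes with P becomes -s Q P, again a Pauli string up to sign.\<close>

lemma clifford_pauli_rot:
  assumes n: "n \<ge> 1" and s: "s = 1 \<or> s = -1"
  shows "clifford n (pauli_rot n s)"
proof -
  let ?d = "2 ^ n" and ?P = "pauli n (2^n - 1) 1"
  have adj: "adj (pauli_rot n s) = pauli_rot n (-s)"
    using s by (intro pauli_rot_adj n) auto
  have "pauli_rot n s * adj (pauli_rot n s) = 1\<^sub>m ?d"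
    "adj (pauli_rot n s) * pauli_rot n s = 1\<^sub>m ?d"
    unfolding adj pauli_rot_mult[OF n] using s by (auto intro!: eq_matI)
  moreover have "\<exists>k::nat. \<exists>a' b'. a' < 2^n \<and> b' < 2^n \<and>
      pauli_rot n s * pauli n a b * adj (pauli_rot n s) = (\<i> ^ k) \<cdot>\<^sub>m pauli n a' b'"
    if ab: "a < 2 ^ n" "b < 2 ^ n" for a b
  proof -
    let ?Q = "pauli n a b"
    \<comment> \<open>The commutation sign of P and Q: P Q = e Q P.\<close>
    define e where "e = zsign n 1 a * zsign n b (2^n - 1)"
    have e: "e = 1 \<or> e = -1"
      using zsign_cases[of n 1 a] zsign_cases[of n b "2^n - 1"] by (auto simp: e_def)
    have PQ: "?P * ?Q = e \<cdot>\<^sub>m (?Q * ?P)"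
      unfolding e_def using ab by (intro pauli_commute) auto
    \<comment> \<open>Pulling Q to the left through 1 + s P turns s into e s, so the conjugation
      reduces to a product of two rotations.\<close>
    have "pauli_rot n s * ?Q = ?Q * pauli_rot n (e * s)"
      unfolding pauli_rot_def
      by (simp add: square_mat_distribs[of _ ?d] square_mat_smults[of _ ?d] PQ[simplified] mult.commute)
    then have "pauli_rot n s * ?Q * adj (pauli_rot n s)
        = ?Q * (pauli_rot n (e * s) * pauli_rot n (-s))"
      unfolding adj by (simp add: assoc_mult_mat[where n\<^sub>1 = ?d and n\<^sub>2 = ?d and n\<^sub>3 = ?d and n\<^sub>4 = ?d])
    \<comment> \<open>Here s s = 1 simplifies 1 - (e s)(-s) to 1 + e.\<close>
    also have "\<dots> = ?Q * (((1 + e) / 2) \<cdot>\<^sub>m 1\<^sub>m ?d + ((e * s - s) / 2) \<cdot>\<^sub>m ?P)"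
      using s by (auto simp: pauli_rot_mult[OF n])
    finally have eq: "pauli_rot n s * ?Q * adj (pauli_rot n s)
      = ?Q * (((1 + e) / 2) \<cdot>\<^sub>m 1\<^sub>m ?d + ((e * s - s) / 2) \<cdot>\<^sub>m ?P)" .
    from e show ?thesis
    proof
      assume "e = 1"
      then have "pauli_rot n s * ?Q * adj (pauli_rot n s) = (\<i> ^ 0) \<cdot>\<^sub>m ?Q"
        unfolding eq by (auto simp: square_mat_distribs[of _ ?d] square_mat_smults[of _ ?d]
            intro!: eq_matI)
      with ab show ?thesis by blast
    next
      assume "e = -1"
      then have "pauli_rot n s * ?Q * adj (pauli_rot n s) = (-s) \<cdot>\<^sub>m (?Q * ?P)"
        unfolding eq by (auto simp: square_mat_distribs[of _ ?d] square_mat_smults[of _ ?d]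
            intro!: eq_matI)
      also have "\<dots> = (- s * zsign n b (2^n - 1)) \<cdot>\<^sub>m pauli n (xor a (2^n - 1)) (xor b 1)"
        by (subst pauli_mult) (auto intro!: eq_matI)
      finally have r: "pauli_rot n s * ?Q * adj (pauli_rot n s)
        = (- s * zsign n b (2^n - 1)) \<cdot>\<^sub>m pauli n (xor a (2^n - 1)) (xor b 1)" .
      obtain k :: nat where k: "- s * zsign n b (2^n - 1) = \<i> ^ k"
        using sign_is_power_of_i[of "- s * zsign n b (2^n - 1)"] s zsign_cases[of n b "2^n - 1"]
        by auto
      have "xor a (2^n - 1) < 2^n" "xor b 1 < 2^n"
        using ab one_less_power[of "2::nat" n] n by (auto intro!: xor_less_exp)
      with r k show ?thesis by metis
    qed
  qed
  ultimately show ?thesis by (simp add: clifford_def unitary_mat_def)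
qed

text \<open>For s = 1 or s = -1, the density matrix of (|0> + s |N>)/sqrt 2 with N = 2^n -
  1.\<close>

definition ghz :: "nat \<Rightarrow> real \<Rightarrow> complex mat" where
  "ghz n s = mat (2^n) (2^n) (\<lambda>(i,j).
     if i \<in> {0, 2^n - 1} \<and> j \<in> {0, 2^n - 1}
     then (if i = j then 1/2 else complex_of_real s / 2) else 0)"

lemma ghz_stab:
  assumes n: "n \<ge> 1" and s: "s = 1 \<or> s = -1"
  shows "ghz n s \<in> stab_states n"
proof -
  let ?C = "pauli_rot n (complex_of_real s)"
  have "(1::nat) < 2 ^ n" using n by (intro one_less_power) auto
  \<comment> \<open>The two corners are distinct indices, so column 0 of the rotation has separate
    entries for 1 and s P.\<close>
  then have N: "(2::nat) ^ n - 1 \<noteq> 0" by simp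
  have C0: "?C $$ (i,0) = complex_of_real (1 / sqrt 2) *
      (if i = 0 then 1 else if i = 2^n - 1 then complex_of_real s else 0)" if "i < 2 ^ n" for i
    using that N by (auto simp: pauli_rot_def pauli_index)
  have "ghz n s = ?C * zero_proj n * adj ?C"
  proof (rule eq_matI)
    fix i j assume "i < dim_row (?C * zero_proj n * adj ?C)" "j < dim_col (?C * zero_proj n * adj ?C)"
    then have ij: "i < 2^n" "j < 2^n" using stab_state_carrier[of ?C n] by auto
    have "(?C * zero_proj n * adj ?C) $$ (i,j) =
      (complex_of_real (1 / sqrt 2) * complex_of_real (1 / sqrt 2)) *
      ((if i = 0 then 1 else if i = 2^n - 1 then complex_of_real s else 0) *
       (if j = 0 then 1 else if j = 2^n - 1 then complex_of_real s else 0))"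
      using ij by (subst stab_state_index) (auto simp: C0)
    then show "ghz n s $$ (i,j) = (?C * zero_proj n * adj ?C) $$ (i,j)"
      unfolding inv_sqrt2_square using ij s N by (auto simp: ghz_def)
  qed (use stab_state_carrier[of ?C n] in \<open>auto simp: ghz_def\<close>)
  moreover have "clifford n ?C" using s by (intro clifford_pauli_rot n) auto
  ultimately show ?thesis by (auto simp: stab_states_def)
qed

section \<open>Entries of stabilizer states\<close>

text \<open>A Pauli string that fixes the state up to a phase and sends |j> to a multiple of |i>
  makes the (i,j) entry a phase times the (j,j) entry. A nonzero (i,j) entry guarantees that such a
  string exists.\<close>

lemma stab_state_offdiag:
  assumes C: "clifford n C" and ij: "i < 2^n" "j < 2^n"
    and nz: "(C * zero_proj n * adj C) $$ (i,j) \<noteq> 0"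
  shows "norm ((C * zero_proj n * adj C) $$ (i,j)) = norm ((C * zero_proj n * adj C) $$ (j,j))"
proof -
  let ?d = "2 ^ n" and ?\<sigma> = "C * zero_proj n * adj C"
  have Cc: "C \<in> carrier_mat ?d ?d" and CC: "adj C * C = 1\<^sub>m ?d"
    using C by (auto simp: clifford_def unitary_mat_def)
  have zp: "zero_proj n \<in> carrier_mat ?d ?d" by (simp add: zero_proj_def)
  have "C $$ (i,0) * cnj (C $$ (j,0)) \<noteq> 0"
    using nz by (simp add: stab_state_index[OF Cc ij])
  \<comment> \<open>The (i,j) entry of the state is the value at 0 of l \<mapsto> C(i,l) cnj
    (C(j,l)); the Walsh coefficients of this function are the (i,j) entries of the conjugated
    Z-strings C Z^b C*.\<close>
  then obtain b where b: "b < ?d"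
    and bnz: "(\<Sum>l<?d. C $$ (i,l) * cnj (C $$ (j,l)) * zsign n b l) \<noteq> 0"
    using walsh_transform_injective[of n "\<lambda>l. C $$ (i,l) * cnj (C $$ (j,l))"] by blast
  obtain k :: nat and a' b' where a': "a' < ?d"
    and P: "C * pauli n 0 b * adj C = (\<i> ^ k) \<cdot>\<^sub>m pauli n a' b'"
    using C b unfolding clifford_def by (metis zero_less_numeral zero_less_power)
  have CZ: "(C * pauli n 0 b) $$ (i,l) = C $$ (i,l) * zsign n b l" if "l < ?d" for l
  proof -
    have "(C * pauli n 0 b) $$ (i,l) = (\<Sum>m<?d. C $$ (i,m) * pauli n 0 b $$ (m,l))"
      using Cc ij that by (intro mat_mult_index) auto
    also have "\<dots> = (\<Sum>m<?d. if m = l then C $$ (i,l) * zsign n b l else 0)"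
      using that by (intro sum.cong) (auto simp: pauli_index)
    finally show ?thesis using that by simp
  qed
  have "(C * pauli n 0 b * adj C) $$ (i,j) = (\<Sum>l<?d. (C * pauli n 0 b) $$ (i,l) * adj C $$ (l,j))"
    using Cc ij by (intro mat_mult_index) auto
  also have "\<dots> = (\<Sum>l<?d. C $$ (i,l) * cnj (C $$ (j,l)) * zsign n b l)"
    using ij by (intro sum.cong) (auto simp: CZ adj_index[OF Cc] simp del: index_mult_mat)
  finally have "(\<i> ^ k) * pauli n a' b' $$ (i,j) \<noteq> 0"
    using bnz ij by (simp add: P)
  \<comment> \<open>A Pauli string has a single nonzero entry in column j, at row j xor a'.\<close>
  then have ia: "i = xor j a'" using ij by (auto simp: pauli_index split: if_splits)
  \<comment> \<open>Z^b fixes |0>, so its conjugate by C fixes the state.\<close>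
  have Z0: "pauli n 0 b * zero_proj n = zero_proj n"
  proof (rule eq_matI)
    fix x y assume "x < dim_row (zero_proj n)" "y < dim_col (zero_proj n)"
    then have xy: "x < ?d" "y < ?d" using zp by auto
    have "(pauli n 0 b * zero_proj n) $$ (x,y) = (\<Sum>m<?d. pauli n 0 b $$ (x,m) * zero_proj n $$ (m,y))"
      using xy zp by (intro mat_mult_index) auto
    also have "\<dots> = (\<Sum>m<?d. if m = x then zero_proj n $$ (x,y) else 0)"
      using xy by (intro sum.cong) (auto simp: pauli_index zero_proj_def)
    finally show "(pauli n 0 b * zero_proj n) $$ (x,y) = zero_proj n $$ (x,y)" using xy by simp
  qed (use zp in auto)
  have "((\<i> ^ k) \<cdot>\<^sub>m pauli n a' b') * ?\<sigma> = C * (pauli n 0 b * ((adj C * C) * (zero_proj n * adj C)))"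
    unfolding P[symmetric] using Cc zp by (simp add: assoc_mult_mat[where n\<^sub>1 = ?d and n\<^sub>2 = ?d and n\<^sub>3 = ?d and n\<^sub>4 = ?d])
  also have "\<dots> = C * ((pauli n 0 b * zero_proj n) * adj C)"
    unfolding CC using Cc zp by (simp add: assoc_mult_mat[where n\<^sub>1 = ?d and n\<^sub>2 = ?d and n\<^sub>3 = ?d and n\<^sub>4 = ?d])
  also have "\<dots> = ?\<sigma>"
    unfolding Z0 using Cc zp by (simp add: assoc_mult_mat[where n\<^sub>1 = ?d and n\<^sub>2 = ?d and n\<^sub>3 = ?d and n\<^sub>4 = ?d])
  finally have fixed: "((\<i> ^ k) \<cdot>\<^sub>m pauli n a' b') * ?\<sigma> = ?\<sigma>" .
  have "?\<sigma> $$ (i,j) = (\<Sum>m<?d. ((\<i> ^ k) \<cdot>\<^sub>m pauli n a' b') $$ (i,m) * ?\<sigma> $$ (m,j))"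
    by (subst fixed[symmetric]) (use ij stab_state_carrier[OF Cc] in \<open>intro mat_mult_index, auto\<close>)
  \<comment> \<open>Row i of the Pauli string meets only column j, so the fixed-point equation links
    (i,j) to (j,j) alone.\<close>
  also have "\<dots> = (\<Sum>m<?d. if m = j then \<i> ^ k * zsign n b' j * ?\<sigma> $$ (j,j) else 0)"
    using ij ia by (intro sum.cong) (auto simp: pauli_index dest: arg_cong[where f = "\<lambda>x. xor x a'"])
  also have "\<dots> = \<i> ^ k * zsign n b' j * ?\<sigma> $$ (j,j)" using ij by simp
  finally show ?thesis by (simp add: norm_mult norm_power)
qed

text \<open>With s the sign of c, this is p x - |c| at the state of the theorem.\<close>
definition gap :: "nat \<Rightarrow> real \<Rightarrow> nat \<Rightarrow> complex mat \<Rightarrow> real" where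
  "gap n s x \<sigma> = Re (\<sigma> $$ (x,x)) - s * Re (\<sigma> $$ (0, 2^n - 1))"

text \<open>Let a, b be the two corner diagonal entries and r the real part of the (0,N) entry. Then
  |r| is at most both a and b, and a + b \<le> 1 by the trace, so a - s r lies between 0 and a +
  b.\<close>

lemma stab_state_gap_trace:
  assumes n: "n \<ge> 1" and s: "s = 1 \<or> s = -1" and x: "x = 0 \<or> x = 2^n - 1"
    and \<sigma>: "\<sigma> \<in> stab_states n"
  shows "0 \<le> gap n s x \<sigma>" "gap n s x \<sigma> \<le> 1" "(\<Sum>i<2^n. Re (\<sigma> $$ (i,i))) = 1"
proof -
  let ?N = "2 ^ n - 1 :: nat"
  obtain C where C: "clifford n C" and \<sigma>C: "\<sigma> = C * zero_proj n * adj C"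
    using \<sigma> by (auto simp: stab_states_def)
  have Cc: "C \<in> carrier_mat (2^n) (2^n)" and CC: "adj C * C = 1\<^sub>m (2^n)"
    using C by (auto simp: clifford_def unitary_mat_def)
  have N: "?N \<noteq> 0" "?N < 2 ^ n"
    using one_less_power[of "2::nat" n] n by auto
  have diag: "\<sigma> $$ (i,i) = complex_of_real ((norm (C $$ (i,0)))\<^sup>2)" if "i < 2 ^ n" for i
    unfolding \<sigma>C stab_state_index[OF Cc that that] by (rule complex_norm_square[symmetric])
  \<comment> \<open>The trace is the squared norm of column 0 of C, which is 1 by unitarity.\<close>
  have "1 = (adj C * C) $$ (0,0)" by (simp add: CC)
  also have "\<dots> = (\<Sum>l<2^n. adj C $$ (0,l) * C $$ (l,0))"
    using Cc by (intro mat_mult_index) auto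
  also have "\<dots> = (\<Sum>l<2^n. \<sigma> $$ (l,l))"
    unfolding \<sigma>C by (intro sum.cong refl, subst stab_state_index[OF Cc])
      (auto simp: adj_index[OF Cc] mult.commute)
  finally have "1 = (\<Sum>l<2^n. \<sigma> $$ (l,l))" .
  then have "Re 1 = Re (\<Sum>l<2^n. \<sigma> $$ (l,l))" by simp
  then show tr: "(\<Sum>i<2^n. Re (\<sigma> $$ (i,i))) = 1" by simp
  have "(\<Sum>i\<in>{0,?N}. Re (\<sigma> $$ (i,i))) \<le> (\<Sum>i<2^n. Re (\<sigma> $$ (i,i)))"
    using N by (intro sum_mono2) (auto simp: diag)
  then have le1: "Re (\<sigma> $$ (0,0)) + Re (\<sigma> $$ (?N,?N)) \<le> 1" using N tr by simp
  have nn: "norm (\<sigma> $$ (i,i)) = Re (\<sigma> $$ (i,i))" if "i < 2 ^ n" for i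
    using that by (simp add: diag del: of_real_power)
  \<comment> \<open>The entries (0,N) and (N,0) agree in absolute value, so the off-diagonal bound
    applies with either corner on the right.\<close>
  have swap: "norm (\<sigma> $$ (0,?N)) = norm (\<sigma> $$ (?N,0))"
    using N by (simp add: \<sigma>C stab_state_index[OF Cc] norm_mult)
  have off: "norm (\<sigma> $$ (i,j)) \<le> norm (\<sigma> $$ (j,j))" if "i < 2 ^ n" "j < 2 ^ n" for i j
    using stab_state_offdiag[OF C that] unfolding \<sigma>C by force
  have "\<bar>Re (\<sigma> $$ (0,?N))\<bar> \<le> norm (\<sigma> $$ (0,?N))" by (rule abs_Re_le_cmod)
  then have bounds: "\<bar>Re (\<sigma> $$ (0,?N))\<bar> \<le> Re (\<sigma> $$ (?N,?N))" "\<bar>Re (\<sigma> $$ (0,?N))\<bar> \<le> Re (\<sigma> $$ (0,0))"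
    using off[of 0 ?N] off[of ?N 0] swap N nn[of 0] nn[of ?N] by auto
  have "0 \<le> a - s * r \<and> a - s * r \<le> 1" if "\<bar>r\<bar> \<le> a" "\<bar>r\<bar> \<le> b" "a + b \<le> 1" for a b r :: real
    using s that by auto
  from this[OF bounds(1) bounds(2)] this[OF bounds(2) bounds(1)]
  show "0 \<le> gap n s x \<sigma>" "gap n s x \<sigma> \<le> 1"
    using x le1 unfolding gap_def by (auto simp: add.commute)
qed

section \<open>The polytope and the robustness\<close>

lemma gap_lin_comb:
  assumes "n \<ge> 1" "x < 2 ^ n"
  shows "gap n s x (lin_comb n m q \<sigma>) = (\<Sum>l<m. q l * gap n s x (\<sigma> l))"
  using assms
  by (simp add: gap_def lin_comb_def sum_distrib_left right_diff_distrib sum_subtractf mult_ac)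

lemma trace_lin_comb:
  "(\<Sum>i<2^n. Re (lin_comb n m q \<sigma> $$ (i,i))) = (\<Sum>l<m. q l * (\<Sum>i<2^n. Re (\<sigma> l $$ (i,i))))"
  unfolding sum_distrib_left by (subst sum.swap) (simp add: lin_comb_def)

lemma stab_polytope_gap_trace:
  assumes n: "n \<ge> 1" and s: "s = 1 \<or> s = -1" and x: "x = 0 \<or> x = 2^n - 1"
    and \<sigma>: "\<sigma> \<in> stab_polytope n"
  shows "0 \<le> gap n s x \<sigma>" "gap n s x \<sigma> \<le> 1" "(\<Sum>i<2^n. Re (\<sigma> $$ (i,i))) = 1"
proof -
  obtain m w \<tau> where w: "\<And>l. l < m \<Longrightarrow> w l \<ge> 0" and \<tau>: "\<And>l. l < m \<Longrightarrow> \<tau> l \<in> stab_states n"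
    and w1: "(\<Sum>l<m. w l) = 1" and eq: "\<sigma> = lin_comb n m w \<tau>"
    using \<sigma> unfolding stab_polytope_def by blast
  have xN: "x < 2 ^ n" using x by auto
  note stab = stab_state_gap_trace[OF n s x \<tau>]
  show "0 \<le> gap n s x \<sigma>"
    unfolding eq gap_lin_comb[OF n xN] using w stab(1) by (intro sum_nonneg) auto
  have "gap n s x \<sigma> \<le> (\<Sum>l<m. w l)"
    unfolding eq gap_lin_comb[OF n xN] using w stab(2) by (intro sum_mono) (simp add: mult_left_le)
  then show "gap n s x \<sigma> \<le> 1" using w1 by simp
  show "(\<Sum>i<2^n. Re (\<sigma> $$ (i,i))) = 1"
    unfolding eq trace_lin_comb using w1 stab(3) by simp
qed

text \<open>Trace one forces the weights to sum to 1, so their absolute sum is 1 plus twice the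
  total negative weight. Only negative weights can lower the gap below 0, each by at most its
  size.\<close>

lemma affine_weights_ge:
  assumes n: "n \<ge> 1" and s: "s = 1 \<or> s = -1" and x: "x = 0 \<or> x = 2^n - 1"
    and \<sigma>: "\<And>l. l < m \<Longrightarrow> \<sigma> l \<in> stab_polytope n"
    and tr: "(\<Sum>i<2^n. Re (lin_comb n m q \<sigma> $$ (i,i))) = 1"
  shows "(\<Sum>l<m. \<bar>q l\<bar>) \<ge> 1 + 2 * max 0 (- gap n s x (lin_comb n m q \<sigma>))"
proof -
  have xN: "x < 2 ^ n" using x by auto
  note stab = stab_polytope_gap_trace[OF n s x \<sigma>]
  have q1: "(\<Sum>l<m. q l) = 1"
    using tr stab(3) unfolding trace_lin_comb by simp
  then have "(\<Sum>l<m. \<bar>q l\<bar>) \<ge> 1" using sum_mono[of "{..<m}" q "\<lambda>l. \<bar>q l\<bar>"] by simp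
  moreover have "- gap n s x (lin_comb n m q \<sigma>) = (\<Sum>l<m. - q l * gap n s x (\<sigma> l))"
    by (simp add: gap_lin_comb[OF n xN] sum_negf)
  \<comment> \<open>\<open>(\<bar>q l\<bar> - q l) / 2\<close> is the negative part of
    \<open>q l\<close>; the estimate uses both bounds 0 and 1 on the gap.\<close>
  moreover have "(\<Sum>l<m. - q l * gap n s x (\<sigma> l)) \<le> (\<Sum>l<m. (\<bar>q l\<bar> - q l) / 2)"
  proof (rule sum_mono)
    fix l assume "l \<in> {..<m}"
    then have g: "0 \<le> gap n s x (\<sigma> l)" "gap n s x (\<sigma> l) \<le> 1" using stab by auto
    show "- q l * gap n s x (\<sigma> l) \<le> (\<bar>q l\<bar> - q l) / 2"
    proof (cases "q l \<ge> 0")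
      case True then show ?thesis using g by simp
    next
      case False
      then have "- q l * gap n s x (\<sigma> l) \<le> - q l" using g by (intro mult_left_le) auto
      then show ?thesis using False by simp
    qed
  qed
  ultimately show ?thesis
    using q1 by (simp add: sum_subtractf flip: sum_divide_distrib)
qed

lemma stab_states_subset_polytope: "\<sigma> \<in> stab_states n \<Longrightarrow> \<sigma> \<in> stab_polytope n"
proof -
  assume \<sigma>: "\<sigma> \<in> stab_states n"
  then obtain C where C: "clifford n C" "\<sigma> = C * zero_proj n * adj C" by (auto simp: stab_states_def)
  then have "\<sigma> \<in> carrier_mat (2^n) (2^n)"
    by (auto simp: clifford_def unitary_mat_def intro!: stab_state_carrier)
  then have "\<sigma> = lin_comb n 1 (\<lambda>_. 1) (\<lambda>_. \<sigma>)"
    by (intro eq_matI) (auto simp: lin_comb_def)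
  then show ?thesis using \<sigma> unfolding stab_polytope_def mem_Collect_eq
    by (intro exI[of _ 1] exI[of _ "\<lambda>_. 1"] exI[of _ "\<lambda>_. \<sigma>"]) simp
qed

section \<open>The states of the theorem and their decompositions\<close>

lemma x_state_trace:
  assumes "n \<ge> 1"
  shows "(\<Sum>i<2^n. Re (x_state n p c $$ (i,i))) = (\<Sum>i<2^n. p i)"
  using one_less_power[of "2::nat" n] assms by (intro sum.cong) (auto simp: x_state_def)

lemma x_state_gap:
  assumes "n \<ge> 1" "x = 0 \<or> x = 2^n - 1"
  shows "gap n s x (x_state n p c) = p x - s * c"
  using one_less_power[of "2::nat" n] assms by (auto simp: gap_def x_state_def)

lemma x_state_in_polytope:
  assumes n: "n \<ge> 1" and p: "\<forall>x<2^n. p x \<ge> 0" and p1: "(\<Sum>x<2^n. p x) = 1"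
    and c: "\<bar>c\<bar> \<le> p 0" "\<bar>c\<bar> \<le> p (2^n - 1)"
  shows "x_state n p c \<in> stab_polytope n"
proof -
  let ?d = "2 ^ n :: nat"
  let ?N = "?d - 1"
  define s :: real where "s = (if c \<ge> 0 then 1 else -1)"
  \<comment> \<open>The diagonal left over once the GHZ state with weight 2|c| has contributed |c|
    at each corner; \<open>c\<close> ensures it is nonnegative.\<close>
  define u where "u l = p l - (if l = 0 then \<bar>c\<bar> else 0) - (if l = ?N then \<bar>c\<bar> else 0)" for l
  \<comment> \<open>Indices below 2^n carry the basis states; the extra index 2^n carries the GHZ
    state.\<close>
  define w where "w l = (if l < ?d then u l else 2 * \<bar>c\<bar>)" for l
  define \<sigma> where "\<sigma> l = (if l < ?d then basis_proj n l else ghz n s)" for l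
  have N: "?N \<noteq> 0" "?N < ?d" using one_less_power[of "2::nat" n] n by auto
  have s: "s = 1 \<or> s = -1" "\<bar>c\<bar> * s = c" by (auto simp: s_def)
  have "w l \<ge> 0 \<and> \<sigma> l \<in> stab_states n" for l
    using p c N s(1) by (auto simp: w_def u_def \<sigma>_def intro: basis_proj_stab ghz_stab[OF n])
  moreover have "(\<Sum>l<Suc ?d. w l) = 1"
    using p1 N by (simp add: w_def u_def sum_subtractf)
  moreover have "x_state n p c = lin_comb n (Suc ?d) w \<sigma>"
  proof (rule eq_matI)
    fix i j assume "i < dim_row (lin_comb n (Suc ?d) w \<sigma>)" "j < dim_col (lin_comb n (Suc ?d) w \<sigma>)"
    then have ij: "i < ?d" "j < ?d" by (auto simp: lin_comb_def)
    have "lin_comb n (Suc ?d) w \<sigma> $$ (i,j)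
        = (\<Sum>l<?d. complex_of_real (u l) * basis_proj n l $$ (i,j))
          + complex_of_real (2 * \<bar>c\<bar>) * ghz n s $$ (i,j)"
      using ij by (simp add: lin_comb_def w_def \<sigma>_def)
    also have "(\<Sum>l<?d. complex_of_real (u l) * basis_proj n l $$ (i,j))
        = (\<Sum>l<?d. if l = i then (if i = j then complex_of_real (u i) else 0) else 0)"
      using ij by (intro sum.cong) (auto simp: basis_proj_def)
    also have "\<dots> = (if i = j then complex_of_real (u i) else 0)" using ij by simp
    also have "complex_of_real (2 * \<bar>c\<bar>) * ghz n s $$ (i,j)
        = (if i \<in> {0,?N} \<and> j \<in> {0,?N} then complex_of_real (if i = j then \<bar>c\<bar> else \<bar>c\<bar> * s) else 0)"
      using ij by (auto simp: ghz_def)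
    finally show "x_state n p c $$ (i,j) = lin_comb n (Suc ?d) w \<sigma> $$ (i,j)"
      using ij N s(2) by (auto simp: x_state_def u_def)
  qed (auto simp: x_state_def lin_comb_def)
  ultimately show ?thesis unfolding stab_polytope_def mem_Collect_eq by blast
qed

text \<open>Naming the deficient corner x and the other one y treats both cases at once. The first
  conclusion says that at most one corner can be deficient.\<close>

lemma x_state_decomposition:
  assumes n: "n \<ge> 1" and p: "\<forall>x<2^n. p x \<ge> 0" and p1: "(\<Sum>x<2^n. p x) = 1"
    and xy: "{x, y} = {0, 2^n - 1}" and c: "p x < \<bar>c\<bar>" "c\<^sup>2 \<le> p x * p y"
  defines "t \<equiv> \<bar>c\<bar> - p x"
  shows "\<bar>c\<bar> < p y"
    and "\<exists>q \<sigma>. (\<forall>l<2. \<sigma> l \<in> stab_polytope n) \<and> x_state n p c = lin_comb n 2 q \<sigma>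
           \<and> (\<Sum>l<2. \<bar>q l\<bar>) = 1 + 2 * t"
proof -
  have x: "x < 2 ^ n" "y < 2 ^ n" using xy by (auto simp: doubleton_eq_iff)
  have t: "t > 0" using c by (simp add: t_def)
  have px: "p x \<ge> 0" "p y \<ge> 0" using p x by auto
  show cy: "\<bar>c\<bar> < p y"
  proof (rule ccontr)
    assume "\<not> \<bar>c\<bar> < p y"
    \<comment> \<open>Otherwise p x p y \<le> p x |c| < c^2, against positivity of the
      state.\<close>
    then have "p x * p y \<le> p x * \<bar>c\<bar>" using px by (intro mult_left_mono) auto
    also have "\<dots> < \<bar>c\<bar> * \<bar>c\<bar>" using c px by (intro mult_strict_right_mono) auto
    finally show False using c by (simp add: power2_eq_square)
  qed
  \<comment> \<open>Adding t at x lifts that entry exactly to |c|; dividing by the new trace 1 + t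
    normalizes the state, and its corner x meets the polytope bound with equality.\<close>
  define p' where "p' i = (p i + (if i = x then t else 0)) / (1 + t)" for i
  define \<rho> where "\<rho> = x_state n p' (c / (1 + t))"
  have "p' x = \<bar>c / (1 + t)\<bar>" using t by (simp add: p'_def t_def abs_divide)
  moreover have "\<bar>c / (1 + t)\<bar> \<le> p' y"
    using t cy by (auto simp: p'_def abs_divide divide_right_mono)
  ultimately have "\<bar>c / (1 + t)\<bar> \<le> p' 0" "\<bar>c / (1 + t)\<bar> \<le> p' (2^n - 1)"
    using xy by (auto simp: doubleton_eq_iff)
  moreover have "(\<Sum>i<2^n. p' i) = 1"
    using p1 x t by (simp add: p'_def sum.distrib flip: sum_divide_distrib)
  moreover have "\<forall>i<2^n. p' i \<ge> 0" using p t by (auto simp: p'_def)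
  ultimately have \<rho>: "\<rho> \<in> stab_polytope n"
    unfolding \<rho>_def by (intro x_state_in_polytope n)
  \<comment> \<open>Undoing the mixing: the state is (1 + t) times \<rho> minus t times
    |x><x|.\<close>
  define q where "q l = (if l = 0 then 1 + t else - t)" for l :: nat
  define \<sigma> where "\<sigma> l = (if l = 0 then \<rho> else basis_proj n x)" for l :: nat
  have "\<forall>l<2. \<sigma> l \<in> stab_polytope n"
    using \<rho> basis_proj_stab[OF x(1)] by (simp add: \<sigma>_def stab_states_subset_polytope)
  moreover have "(\<Sum>l<2. \<bar>q l\<bar>) = 1 + 2 * t"
    using t by (simp add: q_def numeral_2_eq_2)
  moreover have "x_state n p c = lin_comb n 2 q \<sigma>"
  proof (rule eq_matI)
    fix i j assume "i < dim_row (lin_comb n 2 q \<sigma>)" "j < dim_col (lin_comb n 2 q \<sigma>)"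
    then have ij: "i < 2 ^ n" "j < 2 ^ n" by (auto simp: lin_comb_def)
    have p'i: "(1 + t) * p' i = p i + (if i = x then t else 0)" and c': "(1 + t) * (c / (1 + t)) = c"
      using t by (auto simp: p'_def)
    have "lin_comb n 2 q \<sigma> $$ (i,j)
        = complex_of_real (1 + t) * \<rho> $$ (i,j) - complex_of_real t * basis_proj n x $$ (i,j)"
      using ij by (simp add: lin_comb_def q_def \<sigma>_def numeral_2_eq_2)
    also have "complex_of_real (1 + t) * \<rho> $$ (i,j) =
        (if i = j then complex_of_real ((1 + t) * p' i) else 0)
        + (if (i = 0 \<and> j = 2^n - 1) \<or> (i = 2^n - 1 \<and> j = 0)
           then complex_of_real ((1 + t) * (c / (1 + t))) else 0)"
      unfolding of_real_mult using ij by (simp add: \<rho>_def x_state_def distrib_left)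
    finally show "x_state n p c $$ (i,j) = lin_comb n 2 q \<sigma> $$ (i,j)"
      unfolding p'i c' using ij by (auto simp: x_state_def basis_proj_def)
  qed (auto simp: x_state_def lin_comb_def)
  ultimately show "\<exists>q \<sigma>. (\<forall>l<2. \<sigma> l \<in> stab_polytope n) \<and> x_state n p c = lin_comb n 2 q \<sigma>
           \<and> (\<Sum>l<2. \<bar>q l\<bar>) = 1 + 2 * t" by blast
qed

theorem theoremS1:
  fixes n :: nat and p :: "nat \<Rightarrow> real" and c :: real
  assumes "n \<ge> 1"
    and "\<forall>x<2^n. p x \<ge> 0"
    and "(\<Sum>x<2^n. p x) = 1"
    and "c\<^sup>2 \<le> p 0 * p (2^n - 1)"
  shows "(x_state n p c \<in> stab_polytope n \<longleftrightarrow> \<bar>c\<bar> \<le> min (p 0) (p (2^n - 1)))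
       \<and> robustness n (x_state n p c) = 1 + 2 * max 0 (max (\<bar>c\<bar> - p 0) (\<bar>c\<bar> - p (2^n - 1)))"
proof -
  let ?N = "2 ^ n - 1 :: nat"
  let ?\<rho> = "x_state n p c"
  let ?r = "1 + 2 * max 0 (max (\<bar>c\<bar> - p 0) (\<bar>c\<bar> - p ?N))"
  let ?W = "{(\<Sum>l<m. \<bar>q l\<bar>) | m q \<sigma>.
      (\<forall>l<m. \<sigma> l \<in> stab_polytope n) \<and> ?\<rho> = lin_comb n m q \<sigma>}"
  note n = assms(1)
  \<comment> \<open>This sign gives s c = |c|, so one choice of functional yields the sharp bound at
    each corner.\<close>
  define s :: real where "s = (if c \<ge> 0 then 1 else -1)"
  have s: "s = 1 \<or> s = -1" and gap: "gap n s x ?\<rho> = p x - \<bar>c\<bar>" if "x = 0 \<or> x = ?N" for x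
    using x_state_gap[OF n that] by (auto simp: s_def)
  have "?\<rho> \<in> stab_polytope n \<longleftrightarrow> \<bar>c\<bar> \<le> min (p 0) (p ?N)"
  proof
    assume "?\<rho> \<in> stab_polytope n"
    then have "0 \<le> gap n s 0 ?\<rho>" "0 \<le> gap n s ?N ?\<rho>"
      using stab_polytope_gap_trace(1)[OF n s] by auto
    then show "\<bar>c\<bar> \<le> min (p 0) (p ?N)" by (simp add: gap[simplified])
  qed (use assms in \<open>auto intro: x_state_in_polytope\<close>)
  moreover have "robustness n ?\<rho> = ?r"
    unfolding robustness_def
  \<comment> \<open>The infimum is attained: an explicit decomposition reaches the value, and the
    gap bounds every decomposition from below.\<close>
  proof (rule cInf_eq_minimum)
    show "?r \<in> ?W"
    proof -
      consider (in_polytope) "\<bar>c\<bar> \<le> p 0" "\<bar>c\<bar> \<le> p ?N" | (zero) "p 0 < \<bar>c\<bar>" | (ones) "p ?N < \<bar>c\<bar>"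
        by linarith
      then show ?thesis
      proof cases
        case in_polytope
        then have "?\<rho> \<in> stab_polytope n" using assms by (intro x_state_in_polytope) auto
        moreover have "?\<rho> = lin_comb n 1 (\<lambda>_. 1) (\<lambda>_. ?\<rho>)"
          by (rule eq_matI) (auto simp: lin_comb_def x_state_def)
        ultimately show ?thesis using in_polytope
          by (intro CollectI exI[of _ 1] exI[of _ "\<lambda>_. 1"] exI[of _ "\<lambda>_. ?\<rho>"]) simp
      next
        case zero
        have c2: "c\<^sup>2 \<le> p 0 * p ?N" using assms(4) by (simp add: mult.commute)
        have corners: "{0, ?N} = {0, ?N}" by (simp add: insert_commute)
        note dec = x_state_decomposition[OF assms(1-3) corners zero c2]
        obtain q \<sigma> where "\<forall>l<2. \<sigma> l \<in> stab_polytope n" "?\<rho> = lin_comb n 2 q \<sigma>"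
          and sum: "(\<Sum>l<2. \<bar>q l\<bar>) = 1 + 2 * (\<bar>c\<bar> - p 0)"
          using dec(2) by blast
        \<comment> \<open>The other corner exceeds |c|, so the maximum is attained at the deficient
          one.\<close>
        moreover have "?r = (\<Sum>l<2. \<bar>q l\<bar>)"
          unfolding sum using dec(1) zero by (simp add: max_def)
        ultimately show ?thesis
          by (intro CollectI exI[of _ 2] exI[of _ q] exI[of _ \<sigma>] conjI)
      next
        case ones
        have c2: "c\<^sup>2 \<le> p ?N * p 0" using assms(4) by (simp add: mult.commute)
        have corners: "{?N, 0} = {0, ?N}" by (simp add: insert_commute)
        note dec = x_state_decomposition[OF assms(1-3) corners ones c2]
        obtain q \<sigma> where "\<forall>l<2. \<sigma> l \<in> stab_polytope n" "?\<rho> = lin_comb n 2 q \<sigma>"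
          and sum: "(\<Sum>l<2. \<bar>q l\<bar>) = 1 + 2 * (\<bar>c\<bar> - p ?N)"
          using dec(2) by blast
        moreover have "?r = (\<Sum>l<2. \<bar>q l\<bar>)"
          unfolding sum using dec(1) ones by (simp add: max_def)
        ultimately show ?thesis
          by (intro CollectI exI[of _ 2] exI[of _ q] exI[of _ \<sigma>] conjI)
      qed
    qed
  next
    fix z assume "z \<in> ?W"
    then obtain m q \<sigma> where z: "z = (\<Sum>l<m. \<bar>q l\<bar>)" and eq: "?\<rho> = lin_comb n m q \<sigma>"
      and \<sigma>: "\<And>l. l < m \<Longrightarrow> \<sigma> l \<in> stab_polytope n" by blast
    have "(\<Sum>i<2^n. Re (lin_comb n m q \<sigma> $$ (i,i))) = 1"
      using x_state_trace[OF n, of p c] assms(3) by (simp add: eq)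
    then have "z \<ge> 1 + 2 * max 0 (- gap n s x ?\<rho>)" if "x = 0 \<or> x = ?N" for x
      unfolding z eq using that \<sigma> s by (intro affine_weights_ge n) auto
    \<comment> \<open>The two corner bounds together give the maximum in the claimed value.\<close>
    from this[of 0] this[of ?N] show "?r \<le> z" by (simp add: gap[simplified] max_def split: if_splits)
  qed
  ultimately show ?thesis by blast
qed

end
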